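(* Let $L$ be a frame and $I$ an interpretation with values in $L$ and nonempty domain $D$. Let $X$ be the set of all sequences over $D$ and $A$ the collection of all geometric formulae, and for $s\in X$, $\phi\in A$ put $gr(s\models\phi)=gr(s\ \mathrm{sat}\ \phi)$. Define $\phi\approx\psi$ iff $gr(s\models\phi)=gr(s\models\psi)$ for all $s\in X$; this is an equivalence relation, with classes $[\phi]$. Order $A/_{\approx}$ by $[\phi]\le[\psi]$ iff $gr(s\models\phi)\le gr(s\models\psi)$ for all $s\in X$. Then $A/_{\approx}$ is a frame, in which $[\phi]\wedge[\psi]=[\phi\wedge\psi]$ and $\bigvee_{i}[\phi_i]=[\bigvee\{\phi_i\}_{i}]$, and, with $gr(s\models'[\phi])=gr(s\models\phi)$ (well defined), the triple $(X,\models',A/_{\approx})$ is an $L$-topological system.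
   Context: A frame is a complete lattice $L$ (bottom $0_L$, top $1_L$) with $x\wedge\bigvee Y=\bigvee\{x\wedge y\mid y\in Y\}$. Language: constants $c_1,c_2,\dots$; variables $x_1,x_2,\dots$; $\top,\bot$; predicate symbols $p^i_j$ and function symbols $f^i_j$ of each arity $i>0$; identity $=$. Terms: constants, variables, $f^i_jt_1\dots t_i$. Geometric formulae: $\top$, $\bot$, $p^i_jt_1\dots t_i$, $(t=t')$, $(\phi\wedge\psi)$, $\bigvee\{\phi_i\}_{i\in I}$ for any indexed family, $\exists x_i\phi$. An interpretation $I$: a set $D$, $I(c_i)\in D$, $I(f^i_j):D^i\to D$, $I(p^i_j):D^i\to L$. Sequences $s=(s_1,s_2,\dots)$ over $D$; $s(d/x_k)$ replaces the $k$-th coordinate by $d$. Term evaluation: $s(c_i)=I(c_i)$, $s(x_k)=s_k$, $s(f^i_jt_1\dots t_i)=I(f^i_j)(s(t_1),\dots,s(t_i))$. Grade of satisfaction $gr(s\ \mathrm{sat}\ \phi)\in L$: atomic predicate gives $I(p^i_j)(s(t_1),\dots,s(t_i))$; $\top\mapsto1_L$; $\bot\mapsto0_L$; $t=t'\mapsto1_L$ if $s(t)=s(t')$ else $0_L$; $\wedge\mapsto$ meet; $\bigvee\{\phi_i\}\mapsto\sup_i gr(s\ \mathrm{sat}\ \phi_i)$; $\exists x_k\phi\mapsto\sup_{d\in D}gr(s(d/x_k)\ \mathrm{sat}\ \phi)$. An $L$-topological system is a triple $(X,\models,A)$ with $X$ a nonempty set, $A$ a frame and $\models:X\times A\to L$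 (written $gr(x\models a)$) such that for every finite $S\subseteq A$, $gr(x\models\bigwedge S)=\inf\{gr(x\models a)\mid a\in S\}$ (with $\bigwedge\emptyset=\top_A$ and $\inf\emptyset=1_L$), and for every $S\subseteq A$, $gr(x\models\bigvee S)=\sup\{gr(x\models a)\mid a\in S\}$. *)

theory Defs
  imports "HOL-Algebra.Complete_Lattice" "HOL-Library.FuncSet" "HOL-Library.Equipollence"
begin

locale frame = complete_lattice +
  assumes meet_Sup_distrib:
    "\<lbrakk>x \<in> carrier L; Y \<subseteq> carrier L\<rbrakk> \<Longrightarrow> x \<sqinter> \<Squnion>Y = \<Squnion>{x \<sqinter> y | y. y \<in> Y}"

text \<open>In a complete lattice \<open>\<Sqinter>{}\<close> is the top and \<open>\<Squnion>{}\<close> the bottom element, so the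
  empty cases below say \<open>sat x \<top> = \<top>\<close> and \<open>sat x \<bottom> = \<bottom>\<close>.\<close>

locale L_topological_system =
  L: frame L + A: frame A
  for L :: "('l, 'm) gorder_scheme" (structure)
    and X :: "'x set"
    and sat :: "'x \<Rightarrow> 'a \<Rightarrow> 'l"
    and A :: "('a, 'n) gorder_scheme" +
  assumes nonempty: "X \<noteq> {}"
    and sat_closed: "\<lbrakk>x \<in> X; a \<in> carrier A\<rbrakk> \<Longrightarrow> sat x a \<in> carrier L"
    and sat_Inf: "\<lbrakk>x \<in> X; finite S; S \<subseteq> carrier A\<rbrakk> \<Longrightarrow>
                    sat x (\<Sqinter>\<^bsub>A\<^esub>S) = \<Sqinter>\<^bsub>L\<^esub>{sat x a | a. a \<in> S}"
    and sat_Sup: "\<lbrakk>x \<in> X; S \<subseteq> carrier A\<rbrakk> \<Longrightarrow>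
                    sat x (\<Squnion>\<^bsub>A\<^esub>S) = \<Squnion>\<^bsub>L\<^esub>{sat x a | a. a \<in> S}"

text \<open>\<open>Fun i j ts\<close> and \<open>Pred i j ts\<close> apply the \<open>j\<close>-th symbol of arity \<open>i\<close>;
  arities are enforced by \<open>wf_tm\<close> and \<open>wf_fm\<close>. All subscripts range over \<open>nat\<close>,
  starting from 0.\<close>

datatype tm = Const nat | Var nat | Fun nat nat "tm list"

fun wf_tm :: "tm \<Rightarrow> bool" where
  "wf_tm (Const n) = True"
| "wf_tm (Var k) = True"
| "wf_tm (Fun i j ts) = (0 < i \<and> length ts = i \<and> (\<forall>t \<in> set ts. wf_tm t))"

text \<open>\<open>Disj J F\<close> is the disjunction of the family \<open>F\<close> indexed by the set \<open>J\<close>; the values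
  of \<open>F\<close> outside \<open>J\<close> are irrelevant. The type parameter \<open>'i\<close> is the universe from which
  index sets are taken. The geometric formulae with disjunctions over arbitrary index sets
  form a proper class, so no single type contains them all. The type \<open>'i\<close> is arbitrary
  here; results that need \<open>enough\<close> index sets must assume that \<open>'i\<close> is large,
  e.g. that it has at least as many elements as there are \<open>L\<close>-valued functions on the
  set of sequences (as holds for \<open>'i = (nat \<Rightarrow> 'd) \<Rightarrow> 'l\<close>).\<close>

datatype 'i fm =
    Top
  | Bot
  | Pred nat nat "tm list"
  | Eq tm tm
  | Conj "'i fm" "'i fm"
  | Disj "'i set" "'i \<Rightarrow> 'i fm"
  | Ex nat "'i fm"

primrec wf_fm :: "'i fm \<Rightarrow> bool" where
  "wf_fm Top = True"
| "wf_fm Bot = True"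
| "wf_fm (Pred i j ts) = (0 < i \<and> length ts = i \<and> (\<forall>t \<in> set ts. wf_tm t))"
| "wf_fm (Eq t u) = (wf_tm t \<and> wf_tm u)"
| "wf_fm (Conj p q) = (wf_fm p \<and> wf_fm q)"
| "wf_fm (Disj J F) = (\<forall>i \<in> J. wf_fm (F i))"
| "wf_fm (Ex k p) = wf_fm p"

definition formulae :: "'i fm set" where
  "formulae = {p. wf_fm p}"

record ('d, 'l) interp =
  Dom :: "'d set"
  Cint :: "nat \<Rightarrow> 'd"
  Fint :: "nat \<Rightarrow> nat \<Rightarrow> 'd list \<Rightarrow> 'd"
  Pint :: "nat \<Rightarrow> nat \<Rightarrow> 'd list \<Rightarrow> 'l"

text \<open>\<open>D\<^sup>i\<close> is represented by the lists of length \<open>i\<close> over \<open>D\<close>.\<close>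

definition interpretation_in :: "('l, 'm) gorder_scheme \<Rightarrow> ('d, 'l) interp \<Rightarrow> bool" where
  "interpretation_in L I \<longleftrightarrow>
     (\<forall>n. Cint I n \<in> Dom I) \<and>
     (\<forall>i > 0. \<forall>j. Fint I i j \<in> {ds. length ds = i \<and> set ds \<subseteq> Dom I} \<rightarrow> Dom I) \<and>
     (\<forall>i > 0. \<forall>j. Pint I i j \<in> {ds. length ds = i \<and> set ds \<subseteq> Dom I} \<rightarrow> carrier L)"

definition sequences :: "('d, 'l) interp \<Rightarrow> (nat \<Rightarrow> 'd) set" where
  "sequences I = UNIV \<rightarrow> Dom I"

primrec eval_tm :: "('d, 'l) interp \<Rightarrow> (nat \<Rightarrow> 'd) \<Rightarrow> tm \<Rightarrow> 'd" where
  "eval_tm I s (Const n) = Cint I n"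
| "eval_tm I s (Var k) = s k"
| "eval_tm I s (Fun i j ts) = Fint I i j (map (eval_tm I s) ts)"

primrec gr :: "('l, 'm) gorder_scheme \<Rightarrow> ('d, 'l) interp \<Rightarrow> (nat \<Rightarrow> 'd) \<Rightarrow> 'i fm \<Rightarrow> 'l" where
  "gr L I s Top = \<top>\<^bsub>L\<^esub>"
| "gr L I s Bot = \<bottom>\<^bsub>L\<^esub>"
| "gr L I s (Pred i j ts) = Pint I i j (map (eval_tm I s) ts)"
| "gr L I s (Eq t u) = (if eval_tm I s t = eval_tm I s u then \<top>\<^bsub>L\<^esub> else \<bottom>\<^bsub>L\<^esub>)"
| "gr L I s (Conj p q) = gr L I s p \<sqinter>\<^bsub>L\<^esub> gr L I s q"
| "gr L I s (Disj J F) = \<Squnion>\<^bsub>L\<^esub>((\<lambda>i. gr L I s (F i)) ` J)"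
| "gr L I s (Ex k p) = \<Squnion>\<^bsub>L\<^esub>((\<lambda>d. gr L I (s(k := d)) p) ` Dom I)"

definition approx :: "('l, 'm) gorder_scheme \<Rightarrow> ('d, 'l) interp \<Rightarrow> 'i fm rel" where
  "approx L I = {(p, q). p \<in> formulae \<and> q \<in> formulae \<and>
                         (\<forall>s \<in> sequences I. gr L I s p = gr L I s q)}"

definition fm_class :: "('l, 'm) gorder_scheme \<Rightarrow> ('d, 'l) interp \<Rightarrow> 'i fm \<Rightarrow> 'i fm set" where
  "fm_class L I p = approx L I `` {p}"

definition quotient_order ::
  "('l, 'm) gorder_scheme \<Rightarrow> ('d, 'l) interp \<Rightarrow> 'i fm set gorder" where
  "quotient_order L I =
     \<lparr>carrier = formulae // approx L I,
      eq = (=),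
      le = (\<lambda>P Q. \<exists>p \<in> P. \<exists>q \<in> Q. \<forall>s \<in> sequences I. gr L I s p \<sqsubseteq>\<^bsub>L\<^esub> gr L I s q)\<rparr>"

text \<open>The common grade of the members of a class.\<close>

definition gr_class ::
  "('l, 'm) gorder_scheme \<Rightarrow> ('d, 'l) interp \<Rightarrow> (nat \<Rightarrow> 'd) \<Rightarrow> 'i fm set \<Rightarrow> 'l" where
  "gr_class L I s P = the_elem (gr L I s ` P)"

end

(* Sending a class [p] to the function s |-> gr s p embeds the quotient into the pointwise-ordered
   L-valued functions on sequences, and Conj and Disj are computed pointwise there; so meets, joins
   and the distributive law are inherited from L.  Completeness needs every set of classes to be the
   family of classes of some Disj-family: by the embedding there are at most as many classes as
   L-valued functions on sequences, hence at most as many as elements of the index type. *)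

theory Submission
  imports Defs
begin

section \<open>Suprema and infima in partial orders\<close>

lemma (in partial_order) sup_eqI: "least L s (Upper L A) \<Longrightarrow> \<Squnion>A = s"
  \<comment> \<open>\<open>sup\<close> is a Hilbert choice among the least upper bounds. In a
    \<open>partial_order\<close> least elements are unique up to genuine equality, so exhibiting one
    determines the choice.\<close>
  unfolding sup_def by (rule some_equality) (auto intro: least_unique)

lemma (in partial_order) inf_eqI: "greatest L i (Lower L A) \<Longrightarrow> \<Sqinter>A = i"
  unfolding inf_def by (rule some_equality) (auto intro: greatest_unique)

text \<open>The infimum of \<open>A\<close> is the supremum of its lower bounds: every element of
  \<open>A\<close> lies above all of them, hence above their least upper bound. This suits the
  quotient, where arbitrary joins are named by a connective but arbitrary meets are not.\<close>

lemma (in partial_order) complete_lattice_if_sups: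
  assumes sups: "\<And>A. A \<subseteq> carrier L \<Longrightarrow> \<exists>s. least L s (Upper L A)"
  shows "complete_lattice L"
proof (rule complete_latticeI)
  fix A assume A: "A \<subseteq> carrier L"
  obtain s where s: "least L s (Upper L (Lower L A))"
    using sups[of "Lower L A"] by auto
  have "greatest L s (Lower L A)"
  proof (rule greatest_LowerI)
    fix x assume "x \<in> A"
    with A have "x \<in> Upper L (Lower L A)"
      by (auto intro!: Upper_memI)
    with s show "s \<sqsubseteq> x"
      by (rule least_le)
  next
    fix y assume "y \<in> Lower L A"
    with s show "y \<sqsubseteq> s"
      by (auto intro: least_Upper_above)
  qed (use A s in auto)
  then show "\<exists>i. greatest L i (Lower L A)" ..
qed (rule sups)

section \<open>Grades of formulae under a fixed interpretation\<close>

locale frame_interpretation = frame L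
  for L :: "('l, 'm) gorder_scheme" (structure) +
  fixes I :: "('d, 'l) interp"
  assumes interp: "interpretation_in L I"
begin

lemma sequencesD: "s \<in> sequences I \<Longrightarrow> s k \<in> Dom I"
  by (auto simp: sequences_def)

lemma sequences_upd: "\<lbrakk>s \<in> sequences I; d \<in> Dom I\<rbrakk> \<Longrightarrow> s(k := d) \<in> sequences I"
  by (auto simp: sequences_def)

lemma sequences_nonempty: "sequences I \<noteq> {}"
proof -
  have "(\<lambda>_. Cint I 0) \<in> sequences I"
    using interp by (auto simp: interpretation_in_def sequences_def)
  then show ?thesis by blast
qed

lemma eval_tm_closed: "\<lbrakk>s \<in> sequences I; wf_tm t\<rbrakk> \<Longrightarrow> eval_tm I s t \<in> Dom I"
proof (induction t)
  case (Fun i j ts)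
  then have "Fint I i j \<in> {ds. length ds = i \<and> set ds \<subseteq> Dom I} \<rightarrow> Dom I"
    using interp by (simp add: interpretation_in_def)
  moreover have "map (eval_tm I s) ts \<in> {ds. length ds = i \<and> set ds \<subseteq> Dom I}"
    using Fun by auto
  ultimately have "Fint I i j (map (eval_tm I s) ts) \<in> Dom I"
    by (rule funcset_mem)
  then show ?case by simp
qed (use interp in \<open>auto simp: interpretation_in_def sequencesD\<close>)

lemma gr_closed: "\<lbrakk>s \<in> sequences I; p \<in> formulae\<rbrakk> \<Longrightarrow> gr L I s p \<in> carrier L"
  unfolding formulae_def mem_Collect_eq
\<comment> \<open>The sequence must vary, because \<open>Ex k p\<close> evaluates \<open>p\<close>
  at every update \<open>s(k := d)\<close>.\<close>
proof (induction p arbitrary: s)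
  case (Pred i j ts)
  then have "Pint I i j \<in> {ds. length ds = i \<and> set ds \<subseteq> Dom I} \<rightarrow> carrier L"
    using interp by (simp add: interpretation_in_def)
  moreover have "map (eval_tm I s) ts \<in> {ds. length ds = i \<and> set ds \<subseteq> Dom I}"
    using Pred by (auto intro: eval_tm_closed)
  ultimately have "Pint I i j (map (eval_tm I s) ts) \<in> carrier L"
    by (rule funcset_mem)
  then show ?case by simp
next
  case (Disj J F)
  then show ?case
    by (auto intro!: sup_closed)
next
  case (Ex k p)
  then show ?case
    by (auto intro!: sup_closed sequences_upd)
qed auto

text \<open>The universal property of the join at a single sequence. Quantified over all sequences
  it makes \<open>Disj\<close> the least upper bound in the quotient; \<open>le_gr_Conj_iff\<close>
  plays the dual role for binary meets.\<close>

lemma gr_Disj_le_iff: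
  assumes "s \<in> sequences I" "F \<in> J \<rightarrow> formulae" "x \<in> carrier L"
  shows "gr L I s (Disj J F) \<sqsubseteq> x \<longleftrightarrow> (\<forall>i\<in>J. gr L I s (F i) \<sqsubseteq> x)"
proof -
  let ?G = "(\<lambda>i. gr L I s (F i)) ` J"
  have G: "?G \<subseteq> carrier L"
    using assms by (auto intro: gr_closed)
  show ?thesis
  proof
    assume le: "gr L I s (Disj J F) \<sqsubseteq> x"
    show "\<forall>i\<in>J. gr L I s (F i) \<sqsubseteq> x"
    proof
      fix i assume "i \<in> J"
      then have "gr L I s (F i) \<sqsubseteq> \<Squnion>?G"
        using G by (intro sup_upper) auto
      also have "\<dots> \<sqsubseteq> x"
        using le by simp
      finally show "gr L I s (F i) \<sqsubseteq> x"
        using G \<open>i \<in> J\<close> assms(3) by auto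
    qed
  next
    assume "\<forall>i\<in>J. gr L I s (F i) \<sqsubseteq> x"
    then show "gr L I s (Disj J F) \<sqsubseteq> x"
      using G assms(3) by (auto intro!: sup_least)
  qed
qed

lemma le_gr_Conj_iff:
  assumes "s \<in> sequences I" "p \<in> formulae" "q \<in> formulae" "x \<in> carrier L"
  shows "x \<sqsubseteq> gr L I s (Conj p q) \<longleftrightarrow> x \<sqsubseteq> gr L I s p \<and> x \<sqsubseteq> gr L I s q"
proof -
  have "gr L I s p \<in> carrier L" "gr L I s q \<in> carrier L"
    using assms by (auto intro: gr_closed)
  then show ?thesis
    using assms(4) by simp (meson le_trans meet_closed meet_le meet_left meet_right)
qed

text \<open>Here the distributive law of \<open>L\<close> enters. As it holds at every sequence, the
  two formulae are equivalent, which gives the law for classes.\<close>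

lemma gr_Conj_Disj:
  assumes "s \<in> sequences I" "p \<in> formulae" "F \<in> J \<rightarrow> formulae"
  shows "gr L I s (Conj p (Disj J F)) = gr L I s (Disj J (\<lambda>i. Conj p (F i)))"
proof -
  have "gr L I s p \<in> carrier L" "(\<lambda>i. gr L I s (F i)) ` J \<subseteq> carrier L"
    using assms by (auto intro: gr_closed)
  then have "gr L I s p \<sqinter> \<Squnion>((\<lambda>i. gr L I s (F i)) ` J)
      = \<Squnion>{gr L I s p \<sqinter> y | y. y \<in> (\<lambda>i. gr L I s (F i)) ` J}"
    by (rule meet_Sup_distrib)
  also have "{gr L I s p \<sqinter> y | y. y \<in> (\<lambda>i. gr L I s (F i)) ` J}
      = (\<lambda>i. gr L I s p \<sqinter> gr L I s (F i)) ` J"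
    by auto
  finally show ?thesis by simp
qed

lemma Top_formula: "Top \<in> formulae"
  by (simp add: formulae_def)

lemma Conj_formula: "\<lbrakk>p \<in> formulae; q \<in> formulae\<rbrakk> \<Longrightarrow> Conj p q \<in> formulae"
  by (simp add: formulae_def)

lemma Disj_formula: "F \<in> J \<rightarrow> formulae \<Longrightarrow> Disj J F \<in> formulae"
  by (auto simp: formulae_def)

section \<open>Equivalence classes and their order\<close>

lemma equiv_approx: "equiv formulae (approx L I)"
  by (rule equivI) (auto simp: approx_def refl_on_def sym_def trans_def)

abbreviation Q :: "'i fm set gorder" where
  "Q \<equiv> quotient_order L I"

abbreviation cls :: "'i fm \<Rightarrow> 'i fm set" where
  "cls \<equiv> fm_class L I"

lemma carrier_Q: "carrier Q = cls ` formulae"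
  by (auto simp: quotient_order_def quotient_def fm_class_def)

lemma cls_in_Q: "p \<in> formulae \<Longrightarrow> cls p \<in> carrier Q"
  by (simp add: carrier_Q)

lemma cls_eq_iff:
  assumes "p \<in> formulae" "q \<in> formulae"
  shows "cls p = cls q \<longleftrightarrow> (\<forall>s\<in>sequences I. gr L I s p = gr L I s q)"
  using eq_equiv_class_iff[OF equiv_approx assms] assms
  by (auto simp: fm_class_def approx_def)

lemma mem_cls_iff:
  "p \<in> formulae \<Longrightarrow> q \<in> cls p \<longleftrightarrow> q \<in> formulae \<and> (\<forall>s\<in>sequences I. gr L I s q = gr L I s p)"
  by (auto simp: fm_class_def approx_def)

text \<open>The order on classes asks for some pair of representatives. Grades are constant on each
  class, so one pair works exactly when every pair does, in particular \<open>p\<close> and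
  \<open>q\<close> themselves.\<close>

lemma cls_le_iff:
  assumes "p \<in> formulae" "q \<in> formulae"
  shows "cls p \<sqsubseteq>\<^bsub>Q\<^esub> cls q \<longleftrightarrow> (\<forall>s\<in>sequences I. gr L I s p \<sqsubseteq> gr L I s q)"
proof -
  have mem: "p \<in> cls p" "q \<in> cls q"
    using assms by (simp_all add: mem_cls_iff)
  have "cls p \<sqsubseteq>\<^bsub>Q\<^esub> cls q \<longleftrightarrow>
      (\<exists>p'\<in>cls p. \<exists>q'\<in>cls q. \<forall>s\<in>sequences I. gr L I s p' \<sqsubseteq> gr L I s q')"
    by (simp only: quotient_order_def gorder.simps)
  also have "\<dots> \<longleftrightarrow> (\<forall>s\<in>sequences I. gr L I s p \<sqsubseteq> gr L I s q)"
  proof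
    assume "\<exists>p'\<in>cls p. \<exists>q'\<in>cls q. \<forall>s\<in>sequences I. gr L I s p' \<sqsubseteq> gr L I s q'"
    then obtain p' q' where pq': "p' \<in> cls p" "q' \<in> cls q"
      and le: "\<forall>s\<in>sequences I. gr L I s p' \<sqsubseteq> gr L I s q'"
      by blast
    show "\<forall>s\<in>sequences I. gr L I s p \<sqsubseteq> gr L I s q"
    proof
      fix s assume s: "s \<in> sequences I"
      then have "gr L I s p' = gr L I s p" "gr L I s q' = gr L I s q"
        using pq' assms by (auto simp only: mem_cls_iff)
      with s le show "gr L I s p \<sqsubseteq> gr L I s q"
        by metis
    qed
  qed (use mem in blast)
  finally show ?thesis .
qed

text \<open>This is the well-definedness of the grade on classes: all members of
  \<open>cls p\<close> have the grade of \<open>p\<close>, so the image is a singleton and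
  \<open>the_elem\<close> returns its only element.\<close>

lemma gr_class_cls:
  assumes "s \<in> sequences I" "p \<in> formulae"
  shows "gr_class L I s (cls p) = gr L I s p"
proof -
  have "gr L I s ` cls p = {gr L I s p}"
    using assms by (auto simp: mem_cls_iff image_iff)
  then show ?thesis
    by (simp add: gr_class_def)
qed

lemma eq_Q: "(.=\<^bsub>Q\<^esub>) = (=)"
  by (simp only: quotient_order_def eq_object.simps)

lemma partial_order_Q: "partial_order Q"
proof
  fix x y z :: "'i fm set"
  show "x \<in> carrier Q \<Longrightarrow> x \<sqsubseteq>\<^bsub>Q\<^esub> x"
    by (auto simp: carrier_Q cls_le_iff gr_closed)
  show "x .=\<^bsub>Q\<^esub> y"
    if le: "x \<sqsubseteq>\<^bsub>Q\<^esub> y" "y \<sqsubseteq>\<^bsub>Q\<^esub> x" and carr: "x \<in> carrier Q" "y \<in> carrier Q"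
  proof -
    obtain p q where pq: "p \<in> formulae" "q \<in> formulae" and xy: "x = cls p" "y = cls q"
      using carr by (auto simp: carrier_Q)
    have "gr L I s p = gr L I s q" if s: "s \<in> sequences I" for s
    proof (rule le_antisym)
      show "gr L I s p \<sqsubseteq> gr L I s q" "gr L I s q \<sqsubseteq> gr L I s p"
        using le s pq by (auto simp: xy cls_le_iff)
    qed (use s pq in \<open>auto intro: gr_closed\<close>)
    with pq show ?thesis
      by (simp add: eq_Q xy cls_eq_iff)
  qed
  show "x \<sqsubseteq>\<^bsub>Q\<^esub> z"
    if le: "x \<sqsubseteq>\<^bsub>Q\<^esub> y" "y \<sqsubseteq>\<^bsub>Q\<^esub> z" and carr: "x \<in> carrier Q" "y \<in> carrier Q" "z \<in> carrier Q"
  proof -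
    obtain p q r where pqr: "p \<in> formulae" "q \<in> formulae" "r \<in> formulae"
      and xyz: "x = cls p" "y = cls q" "z = cls r"
      using carr by (auto simp: carrier_Q)
    have "gr L I s p \<sqsubseteq> gr L I s r" if s: "s \<in> sequences I" for s
    proof (rule le_trans)
      show "gr L I s p \<sqsubseteq> gr L I s q" "gr L I s q \<sqsubseteq> gr L I s r"
        using le s pqr by (auto simp: xyz cls_le_iff)
    qed (use s pqr in \<open>auto intro: gr_closed\<close>)
    with pqr show ?thesis
      by (simp add: xyz cls_le_iff)
  qed
qed (simp_all add: eq_Q)

section \<open>Joins and meets of classes\<close>

lemma least_cls_Disj:
  assumes F: "F \<in> J \<rightarrow> formulae"
  shows "least Q (cls (Disj J F)) (Upper Q ((\<lambda>i. cls (F i)) ` J))"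
proof -
  \<comment> \<open>The pointwise property \<open>gr_Disj_le_iff\<close>, with the quantifiers over
    sequences and over indices exchanged.\<close>
  have iff: "cls (Disj J F) \<sqsubseteq>\<^bsub>Q\<^esub> cls q \<longleftrightarrow> (\<forall>i\<in>J. cls (F i) \<sqsubseteq>\<^bsub>Q\<^esub> cls q)" if "q \<in> formulae" for q
    using F that Disj_formula[OF F]
    by (subst cls_le_iff) (auto simp: cls_le_iff gr_Disj_le_iff gr_closed Pi_iff simp del: gr.simps)
  show ?thesis
  proof (rule least_UpperI)
    \<comment> \<open>Reflexivity, read through \<open>iff\<close> with the disjunction itself as
      \<open>q\<close>, says that it is an upper bound.\<close>
    have "cls (Disj J F) \<sqsubseteq>\<^bsub>Q\<^esub> cls (Disj J F)"
      using partial_order_Q cls_in_Q[OF Disj_formula[OF F]]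
      by (auto simp: partial_order_def weak_partial_order_def weak_partial_order_axioms_def)
    then show "x \<sqsubseteq>\<^bsub>Q\<^esub> cls (Disj J F)" if "x \<in> (\<lambda>i. cls (F i)) ` J" for x
      using that iff[OF Disj_formula[OF F]] by blast
    show "cls (Disj J F) \<sqsubseteq>\<^bsub>Q\<^esub> y" if y: "y \<in> Upper Q ((\<lambda>i. cls (F i)) ` J)" for y
    proof -
      obtain q where "q \<in> formulae" "y = cls q"
        using y by (auto simp: Upper_def carrier_Q)
      moreover have "\<forall>i\<in>J. cls (F i) \<sqsubseteq>\<^bsub>Q\<^esub> y"
        using y F by (auto simp: Upper_def intro: cls_in_Q)
      ultimately show ?thesis
        using iff by simp
    qed
    show "(\<lambda>i. cls (F i)) ` J \<subseteq> carrier Q"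
      using F by (auto intro: cls_in_Q)
    show "cls (Disj J F) \<in> carrier Q"
      by (rule cls_in_Q[OF Disj_formula[OF F]])
  qed
qed

lemma Sup_cls:
  assumes "F \<in> J \<rightarrow> formulae"
  shows "\<Squnion>\<^bsub>Q\<^esub>((\<lambda>i. cls (F i)) ` J) = cls (Disj J F)"
  by (rule partial_order.sup_eqI[OF partial_order_Q least_cls_Disj[OF assms]])

lemma meet_cls:
  assumes "p \<in> formulae" "q \<in> formulae"
  shows "cls p \<sqinter>\<^bsub>Q\<^esub> cls q = cls (Conj p q)"
proof -
  have pq: "Conj p q \<in> formulae"
    using assms by (rule Conj_formula)
  have iff: "cls r \<sqsubseteq>\<^bsub>Q\<^esub> cls (Conj p q) \<longleftrightarrow> cls r \<sqsubseteq>\<^bsub>Q\<^esub> cls p \<and> cls r \<sqsubseteq>\<^bsub>Q\<^esub> cls q"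
    if "r \<in> formulae" for r
    using assms that pq
    by (auto simp: cls_le_iff le_gr_Conj_iff gr_closed simp del: gr.simps)
  interpret Q: partial_order Q
    by (rule partial_order_Q)
  \<comment> \<open>As for joins, \<open>iff\<close> at \<open>r = Conj p q\<close> together with
    reflexivity yields the lower bound, and \<open>iff\<close> at arbitrary \<open>r\<close> that it
    is the greatest.\<close>
  have "greatest Q (cls (Conj p q)) (Lower Q {cls p, cls q})"
    using iff[OF pq] Q.le_refl[OF cls_in_Q[OF pq]] assms pq
    by (intro greatest_LowerI) (auto simp: carrier_Q Lower_def iff)
  then show ?thesis
    unfolding meet_def by (rule Q.inf_eqI)
qed

section \<open>The number of classes and the choice of index sets\<close>

lemma quotient_lepoll: "(carrier Q :: 'i fm set set) \<lesssim> (sequences I \<rightarrow>\<^sub>E carrier L)"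
proof -
  \<comment> \<open>The grade function of a class, cut off outside \<open>sequences I\<close> so
    that it lies in the extensional function space and depends only on the grades that
    \<open>approx\<close> compares.\<close>
  let ?g = "\<lambda>P :: 'i fm set. \<lambda>s\<in>sequences I. gr_class L I s P"
  have "inj_on ?g (carrier Q)"
  proof (rule inj_onI)
    fix P P' :: "'i fm set"
    assume "P \<in> carrier Q" "P' \<in> carrier Q" and eq: "?g P = ?g P'"
    then obtain p p' where p: "p \<in> formulae" "P = cls p" "p' \<in> formulae" "P' = cls p'"
      by (auto simp: carrier_Q)
    then have "gr L I s p = gr L I s p'" if "s \<in> sequences I" for s
      using that fun_cong[OF eq, of s] by (simp add: gr_class_cls)
    with p show "P = P'"
      by (simp add: cls_eq_iff)
  qed
  moreover have "?g ` carrier Q \<subseteq> sequences I \<rightarrow>\<^sub>E carrier L"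
    by (auto simp: carrier_Q gr_class_cls gr_closed)
  ultimately show ?thesis
    unfolding lepoll_def by blast
qed

text \<open>A supremum of classes can be written as a \<open>Disj\<close> only if the classes are
  indexed by elements of \<open>'i\<close>. The size assumption injects the whole quotient into
  \<open>'i\<close>, so any set of classes can be indexed by its own image.\<close>

lemma set_of_classes_as_family:
  assumes "(sequences I \<rightarrow>\<^sub>E carrier L) \<lesssim> (UNIV :: 'i set)" and S: "S \<subseteq> carrier Q"
  obtains J and F :: "'i \<Rightarrow> 'i fm" where "F \<in> J \<rightarrow> formulae" "S = (\<lambda>i. cls (F i)) ` J"
proof -
  have "(carrier Q :: 'i fm set set) \<lesssim> (UNIV :: 'i set)"
    using quotient_lepoll assms(1) by (rule lepoll_trans)
  then obtain f :: "'i fm set \<Rightarrow> 'i" where f: "inj_on f (carrier Q)"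
    unfolding lepoll_def by blast
  have inv: "inv_into (carrier Q) f (f P) = P" if "P \<in> S" for P
    using f S that by (auto intro: inv_into_f_f)
  \<comment> \<open>A choice of one formula from each class.\<close>
  define rep where "rep = inv_into formulae (cls :: 'i fm \<Rightarrow> _)"
  have rep: "rep P \<in> formulae" "cls (rep P) = P" if "P \<in> S" for P
  proof -
    have "P \<in> cls ` formulae"
      using S that by (auto simp only: carrier_Q)
    then show "rep P \<in> formulae" "cls (rep P) = P"
      unfolding rep_def by (rule inv_into_into, rule f_inv_into_f)
  qed
  show ?thesis
  proof
    show "(\<lambda>i. rep (inv_into (carrier Q) f i)) \<in> f ` S \<rightarrow> formulae"
      using rep inv by auto
    show "S = (\<lambda>i. cls (rep (inv_into (carrier Q) f i))) ` f ` S"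
      using rep inv by (auto simp: image_iff)
  qed
qed

section \<open>The quotient is a frame\<close>

lemma frame_Q:
  assumes large: "(sequences I \<rightarrow>\<^sub>E carrier L) \<lesssim> (UNIV :: 'i set)"
  shows "frame (Q :: 'i fm set gorder)"
proof -
  interpret Q: complete_lattice "Q :: 'i fm set gorder"
  proof (rule partial_order.complete_lattice_if_sups[OF partial_order_Q])
    fix S :: "'i fm set set"
    assume "S \<subseteq> carrier Q"
    with large obtain J and F :: "'i \<Rightarrow> 'i fm"
      where "F \<in> J \<rightarrow> formulae" "S = (\<lambda>i. cls (F i)) ` J"
      by (rule set_of_classes_as_family)
    then show "\<exists>P. least Q P (Upper Q S)"
      using least_cls_Disj by blast
  qed
  show ?thesis
  proof
    fix x :: "'i fm set" and Y
    assume "x \<in> carrier Q" and Y: "(Y :: 'i fm set set) \<subseteq> carrier Q"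
    then obtain p where p: "p \<in> formulae" "x = cls p"
      by (auto simp: carrier_Q)
    \<comment> \<open>With \<open>Y\<close> presented as a family, both sides of the distributive
      law become classes of explicit formulae, and \<open>gr_Conj_Disj\<close> shows these to be
      equivalent.\<close>
    from large Y obtain J and F :: "'i \<Rightarrow> 'i fm"
      where F: "F \<in> J \<rightarrow> formulae" and Y_eq: "Y = (\<lambda>i. cls (F i)) ` J"
      by (rule set_of_classes_as_family)
    have pF: "(\<lambda>i. Conj p (F i)) \<in> J \<rightarrow> formulae"
      using p F by (auto intro!: Conj_formula)
    have "x \<sqinter>\<^bsub>Q\<^esub> \<Squnion>\<^bsub>Q\<^esub>Y = cls (Conj p (Disj J F))"
      using p F by (simp add: Y_eq Sup_cls meet_cls Disj_formula)
    also have "\<dots> = cls (Disj J (\<lambda>i. Conj p (F i)))"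
      using p F pF by (subst cls_eq_iff) (auto intro!: Conj_formula Disj_formula gr_Conj_Disj simp del: gr.simps)
    also have "\<dots> = \<Squnion>\<^bsub>Q\<^esub>((\<lambda>i. cls (Conj p (F i))) ` J)"
      using pF by (simp add: Sup_cls)
    also have "(\<lambda>i. cls (Conj p (F i))) ` J = {x \<sqinter>\<^bsub>Q\<^esub> y | y. y \<in> Y}"
    proof -
      have "cls (Conj p (F i)) = x \<sqinter>\<^bsub>Q\<^esub> cls (F i)" if "i \<in> J" for i
        using meet_cls[OF p(1) funcset_mem[OF F that]] p(2) by simp
      then have "(\<lambda>i. cls (Conj p (F i))) ` J = (\<lambda>i. x \<sqinter>\<^bsub>Q\<^esub> cls (F i)) ` J"
        by (rule image_cong[OF HOL.refl])
      then show ?thesis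
        by (simp add: Y_eq setcompr_eq_image image_image)
    qed
    finally show "x \<sqinter>\<^bsub>Q\<^esub> \<Squnion>\<^bsub>Q\<^esub>Y = \<Squnion>\<^bsub>Q\<^esub>{x \<sqinter>\<^bsub>Q\<^esub> y | y. y \<in> Y}" .
  qed
qed

section \<open>The L-topological system on the quotient\<close>

lemma L_topological_system_Q:
  assumes large: "(sequences I \<rightarrow>\<^sub>E carrier L) \<lesssim> (UNIV :: 'i set)"
  shows "L_topological_system L (sequences I) (gr_class L I) (Q :: 'i fm set gorder)"
proof -
  interpret Q: frame "Q :: 'i fm set gorder"
    using large by (rule frame_Q)
  show ?thesis
  proof
    show "sequences I \<noteq> {}"
      by (rule sequences_nonempty)
    show closed: "gr_class L I s P \<in> carrier L"
      if "s \<in> sequences I" "P \<in> carrier Q" for s and P :: "'i fm set"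
      using that by (auto simp: carrier_Q gr_class_cls gr_closed)
    show "gr_class L I s (\<Squnion>\<^bsub>Q\<^esub>S) = \<Squnion>{gr_class L I s a | a. a \<in> S}"
      if s: "s \<in> sequences I" and S: "S \<subseteq> carrier Q" for s and S :: "'i fm set set"
    proof -
      \<comment> \<open>Once \<open>S\<close> is a family, its supremum is the class of a
        \<open>Disj\<close>, whose grade is by definition the supremum of the grades.\<close>
      from large S obtain J and F :: "'i \<Rightarrow> 'i fm"
        where F: "F \<in> J \<rightarrow> formulae" and S_eq: "S = (\<lambda>i. cls (F i)) ` J"
        by (rule set_of_classes_as_family)
      have cls_F: "gr_class L I s (cls (F i)) = gr L I s (F i)" if "i \<in> J" for i
        using s funcset_mem[OF F that] by (rule gr_class_cls)
      have "{gr_class L I s a | a. a \<in> S} = (\<lambda>i. gr_class L I s (cls (F i))) ` J"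
        by (auto simp: S_eq)
      also have "\<dots> = (\<lambda>i. gr L I s (F i)) ` J"
        using cls_F by (rule image_cong[OF HOL.refl])
      finally show ?thesis
        using s F by (simp add: S_eq Sup_cls gr_class_cls Disj_formula)
    qed
    show "gr_class L I s (\<Sqinter>\<^bsub>Q\<^esub>S) = \<Sqinter>{gr_class L I s a | a. a \<in> S}"
      if s: "s \<in> sequences I" and "finite S" "S \<subseteq> carrier Q" for s and S :: "'i fm set set"
      using that(2,3)
    \<comment> \<open>The connectives name only the empty meet (\<open>Top\<close>) and binary meets
      (\<open>Conj\<close>), so finite meets are reached by induction.\<close>
    proof (induction S rule: finite_induct)
      case empty
      \<comment> \<open>The infimum of the empty set is the top of the quotient. It is the class of
        \<open>Top\<close>, because no grade exceeds the top of \<open>L\<close>.\<close>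
      have "cls (Top :: 'i fm) .=\<^bsub>Q\<^esub> \<top>\<^bsub>Q\<^esub>"
      proof (rule Q.top_weak_eq)
        show "x \<sqsubseteq>\<^bsub>Q\<^esub> cls Top" if "x \<in> carrier Q" for x :: "'i fm set"
          using that by (auto simp: carrier_Q cls_le_iff Top_formula gr_closed)
      qed (simp add: cls_in_Q Top_formula)
      moreover have "gr_class L I s (cls (Top :: 'i fm)) = \<top>"
        by (simp add: gr_class_cls s Top_formula)
      ultimately have "gr_class L I s (\<top>\<^bsub>Q\<^esub> :: 'i fm set) = \<top>"
        by (simp add: Q.eq_is_equal)
      then show ?case
        using Q.weak_inf_empty weak_inf_empty by (simp add: Q.eq_is_equal eq_is_equal)
    next
      case (insert P S)
      then have P: "P \<in> carrier Q" and S: "S \<subseteq> carrier Q"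
        by auto
      \<comment> \<open>The infimum of \<open>S\<close> lies in the carrier, hence is the class of
        some formula \<open>q\<close>. It need not be known which one: \<open>meet_cls\<close>
        reduces the new infimum to \<open>Conj p q\<close>, and the induction hypothesis supplies
        the grade of \<open>q\<close>.\<close>
      obtain p q where p: "p \<in> formulae" "P = cls p" and q: "q \<in> formulae" "\<Sqinter>\<^bsub>Q\<^esub>S = cls q"
        using P Q.inf_closed[OF S] by (auto simp: carrier_Q)
      have "\<Sqinter>\<^bsub>Q\<^esub>(insert P S) = P \<sqinter>\<^bsub>Q\<^esub> \<Sqinter>\<^bsub>Q\<^esub>S"
        using Q.weak_inf_insert[OF P S] by (simp add: Q.eq_is_equal)
      then have "gr_class L I s (\<Sqinter>\<^bsub>Q\<^esub>(insert P S)) = gr_class L I s P \<sqinter> gr_class L I s (\<Sqinter>\<^bsub>Q\<^esub>S)"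
        using p q s by (simp add: meet_cls gr_class_cls Conj_formula)
      also have "\<dots> = gr_class L I s P \<sqinter> \<Sqinter>{gr_class L I s a | a. a \<in> S}"
        using insert.IH S by simp
      also have "\<dots> = \<Sqinter>(insert (gr_class L I s P) {gr_class L I s a | a. a \<in> S})"
        using weak_inf_insert[of "gr_class L I s P" "{gr_class L I s a | a. a \<in> S}"] closed s P S
        by (force simp: eq_is_equal)
      also have "insert (gr_class L I s P) {gr_class L I s a | a. a \<in> S}
          = {gr_class L I s a | a. a \<in> insert P S}"
        by auto
      finally show ?case .
    qed
  qed
qed

end

theorem theorem7:
  fixes L :: "('l, 'm) gorder_scheme"
    and I :: "('d, 'l) interp"
  assumes "frame L"
    and "interpretation_in L I"
    and "Dom I \<noteq> {}"
    and index_universe: "(sequences I \<rightarrow>\<^sub>E carrier L) \<lesssim> (UNIV :: 'i set)"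
  shows "equiv (formulae :: 'i fm set) (approx L I) \<and>
    (\<forall>p \<in> formulae. \<forall>q \<in> (formulae :: 'i fm set).
       fm_class L I p \<sqsubseteq>\<^bsub>quotient_order L I\<^esub> fm_class L I q \<longleftrightarrow>
       (\<forall>s \<in> sequences I. gr L I s p \<sqsubseteq>\<^bsub>L\<^esub> gr L I s q)) \<and>
    frame (quotient_order L I :: 'i fm set gorder) \<and>
    (\<forall>p \<in> formulae. \<forall>q \<in> (formulae :: 'i fm set).
       fm_class L I p \<sqinter>\<^bsub>quotient_order L I\<^esub> fm_class L I q = fm_class L I (Conj p q)) \<and>
    (\<forall>J. \<forall>F \<in> J \<rightarrow> (formulae :: 'i fm set).
       \<Squnion>\<^bsub>quotient_order L I\<^esub>{fm_class L I (F i) | i. i \<in> J} = fm_class L I (Disj J F)) \<and>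
    (\<forall>s \<in> sequences I. \<forall>p \<in> (formulae :: 'i fm set).
       gr_class L I s (fm_class L I p) = gr L I s p) \<and>
    L_topological_system L (sequences I) (gr_class L I)
      (quotient_order L I :: 'i fm set gorder)"
proof -
  interpret frame_interpretation L I
    using assms(1,2) by (simp add: frame_interpretation_def frame_interpretation_axioms_def)
  have Sup: "\<Squnion>\<^bsub>Q\<^esub>{cls (F i) | i. i \<in> J} = cls (Disj J F)" if "F \<in> J \<rightarrow> formulae"
    for J and F :: "'i \<Rightarrow> 'i fm"
    using Sup_cls[OF that] by (simp add: setcompr_eq_image)
  show ?thesis
    by (intro conjI ballI allI equiv_approx cls_le_iff frame_Q[OF index_universe] meet_cls Sup
        gr_class_cls L_topological_system_Q[OF index_universe])
qed

end
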